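(* Let $\mathbb{F}_q$ be a finite field with $q=p^m$ elements, $p$ prime. The number $\mathcal{N}(2,\mathbb{F}_q)$ of isomorphism classes of $2$-dimensional idempotent evolution algebras over $\mathbb{F}_q$ is $$\mathcal{N}(2,\mathbb{F}_q)=\begin{cases}\frac{(q+1)^2}{2}+\frac12, & p=2,\ 3\mid(q-1);\\[2pt] \frac{(q+1)^2}{2}-\frac12, & p=2,\ 3\nmid(q-1);\\[2pt] \frac{(q+1)^2}{2}, & p\neq2,\ 3\mid(q-1);\\[2pt] \frac{(q+1)^2}{2}-1, & p\ne2,\ 3\nmid(q-1).\end{cases}$$
   Context: An $n$-dimensional evolution algebra over a field $\mathbb{F}$ is a (not necessarily associative) $\mathbb{F}$-algebra $\mathcal{E}$ having a vector space basis $e_1,\dots,e_n$ (a natural basis) such that $e_ie_j=0$ for $i\neq j$; its structure matrix is the $n\times n$ matrix $A$ with $(e_1^2,\dots,e_n^2)=(e_1,\dots,e_n)A$. It is called idempotent if $\mathcal{E}^2=\mathcal{E}$ (equivalently, $A$ is nonsingular). Isomorphism means isomorphism of $\mathbb{F}$-algebras. *)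

theory Defs
  imports "HOL-Analysis.Cartesian_Space" "HOL-Computational_Algebra.Primes"
begin

text \<open>
  An algebra is a vector space, given by its scalar multiplication on a type, together with a
  bilinear product, which is not assumed to be associative, commutative or unital.
\<close>

definition is_algebra ::
    "('a::field \<Rightarrow> 'v::ab_group_add \<Rightarrow> 'v) \<Rightarrow> ('v \<Rightarrow> 'v \<Rightarrow> 'v) \<Rightarrow> bool" where
  "is_algebra smul prd \<longleftrightarrow>
     vector_space smul \<and>
     (\<forall>x. Vector_Spaces.linear smul smul (\<lambda>y. prd x y)) \<and>
     (\<forall>y. Vector_Spaces.linear smul smul (\<lambda>x. prd x y))"

definition natural_basis ::
    "nat \<Rightarrow> ('a::field \<Rightarrow> 'v::ab_group_add \<Rightarrow> 'v) \<Rightarrow> ('v \<Rightarrow> 'v \<Rightarrow> 'v) \<Rightarrow> (nat \<Rightarrow> 'v) \<Rightarrow> bool" where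
  "natural_basis n smul prd e \<longleftrightarrow>
     inj_on e {1..n} \<and>
     \<not> module.dependent smul (e ` {1..n}) \<and>
     module.span smul (e ` {1..n}) = UNIV \<and>
     (\<forall>i\<in>{1..n}. \<forall>j\<in>{1..n}. i \<noteq> j \<longrightarrow> prd (e i) (e j) = 0)"

definition evolution_algebra ::
    "nat \<Rightarrow> ('a::field \<Rightarrow> 'v::ab_group_add \<Rightarrow> 'v) \<Rightarrow> ('v \<Rightarrow> 'v \<Rightarrow> 'v) \<Rightarrow> bool" where
  "evolution_algebra n smul prd \<longleftrightarrow>
     is_algebra smul prd \<and> (\<exists>e. natural_basis n smul prd e)"

text \<open>The subspace spanned by all products is the square of the algebra.\<close>

definition idempotent_algebra ::
    "('a::field \<Rightarrow> 'v::ab_group_add \<Rightarrow> 'v) \<Rightarrow> ('v \<Rightarrow> 'v \<Rightarrow> 'v) \<Rightarrow> bool" where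
  "idempotent_algebra smul prd \<longleftrightarrow> module.span smul {prd x y | x y. True} = UNIV"

definition algebra_isomorphic ::
    "('a::field \<Rightarrow> 'v::ab_group_add \<Rightarrow> 'v) \<Rightarrow> ('v \<Rightarrow> 'v \<Rightarrow> 'v) \<Rightarrow>
     ('a \<Rightarrow> 'w::ab_group_add \<Rightarrow> 'w) \<Rightarrow> ('w \<Rightarrow> 'w \<Rightarrow> 'w) \<Rightarrow> bool" where
  "algebra_isomorphic s1 m1 s2 m2 \<longleftrightarrow>
     (\<exists>f. Vector_Spaces.linear s1 s2 f \<and> bij f \<and> (\<forall>x y. f (m1 x y) = m2 (f x) (f y)))"

text \<open>
  Isomorphism classes are counted among the algebra structures on the coordinate space.
  Nothing is lost: by \<open>idempotent_evolution_algebra_has_coordinate_model\<close> below, an idempotent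
  evolution algebra of dimension \<open>CARD('n)\<close> on an arbitrary type is isomorphic to one of these.
\<close>

definition idempotent_evolution_products ::
    "('a::field ^ 'n \<Rightarrow> 'a ^ 'n \<Rightarrow> 'a ^ 'n) set" where
  "idempotent_evolution_products =
     {prd. evolution_algebra CARD('n) ((*s) :: 'a \<Rightarrow> 'a ^ 'n \<Rightarrow> 'a ^ 'n) prd \<and>
            idempotent_algebra ((*s) :: 'a \<Rightarrow> 'a ^ 'n \<Rightarrow> 'a ^ 'n) prd}"

definition product_isomorphism_rel ::
    "(('a::field ^ 'n \<Rightarrow> 'a ^ 'n \<Rightarrow> 'a ^ 'n) \<times> ('a ^ 'n \<Rightarrow> 'a ^ 'n \<Rightarrow> 'a ^ 'n)) set" where
  "product_isomorphism_rel =
     {(m1, m2). m1 \<in> idempotent_evolution_products \<and> m2 \<in> idempotent_evolution_products \<and>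
                algebra_isomorphic (*s) m1 (*s) m2}"

definition num_idempotent_evolution_algebras :: "'n::finite itself \<Rightarrow> 'a::field itself \<Rightarrow> nat" where
  "num_idempotent_evolution_algebras n a =
     card ((idempotent_evolution_products :: ('a ^ 'n \<Rightarrow> 'a ^ 'n \<Rightarrow> 'a ^ 'n) set)
             // product_isomorphism_rel)"

lemma algebra_isomorphic_refl:
  "vector_space s \<Longrightarrow> algebra_isomorphic s m s m"
  unfolding algebra_isomorphic_def
  by (rule exI[of _ id]) (auto simp: vector_space.linear_id)

lemma linear_inv_if_bij:
  assumes f: "Vector_Spaces.linear s1 s2 f" and b: "bij f"
  shows "Vector_Spaces.linear s2 s1 (inv f)"
proof -
  interpret l: Vector_Spaces.linear s1 s2 f by (rule f)
  interpret p: vector_space_pair s1 s2 by unfold_locales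
  obtain g where g: "Vector_Spaces.linear s2 s1 g" "g \<circ> f = id"
    using p.linear_injective_left_inverse[OF f] b by (auto simp: bij_def)
  have "inv f = g"
  proof
    fix x
    obtain y where y: "x = f y" using b by (metis bij_pointE)
    then show "inv f x = g x" using g(2) b
      by (metis bij_is_inj comp_apply id_apply inv_f_f)
  qed
  then show ?thesis using g by simp
qed

lemma algebra_isomorphic_sym:
  assumes "algebra_isomorphic s1 m1 s2 m2"
  shows "algebra_isomorphic s2 m2 s1 m1"
proof -
  obtain f where f: "Vector_Spaces.linear s1 s2 f" "bij f" "\<And>x y. f (m1 x y) = m2 (f x) (f y)"
    using assms by (auto simp: algebra_isomorphic_def)
  have "inv f (m2 x y) = m1 (inv f x) (inv f y)" for x y
    using f(2,3) by (metis bij_inv_eq_iff)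
  then show ?thesis
    unfolding algebra_isomorphic_def using linear_inv_if_bij[OF f(1,2)] bij_imp_bij_inv[OF f(2)] by blast
qed

lemma algebra_isomorphic_trans:
  assumes "algebra_isomorphic s1 m1 s2 m2" and "algebra_isomorphic s2 m2 s3 m3"
  shows "algebra_isomorphic s1 m1 s3 m3"
proof -
  obtain f where f: "Vector_Spaces.linear s1 s2 f" "bij f" "\<And>x y. f (m1 x y) = m2 (f x) (f y)"
    using assms(1) by (auto simp: algebra_isomorphic_def)
  obtain g where g: "Vector_Spaces.linear s2 s3 g" "bij g" "\<And>x y. g (m2 x y) = m3 (g x) (g y)"
    using assms(2) by (auto simp: algebra_isomorphic_def)
  show ?thesis
    unfolding algebra_isomorphic_def
    by (rule exI[of _ "g \<circ> f"])
       (use f g in \<open>auto intro: Vector_Spaces.linear_compose bij_comp\<close>)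
qed

lemma equiv_product_isomorphism_rel:
  "equiv idempotent_evolution_products product_isomorphism_rel"
  unfolding equiv_def refl_on_def sym_def trans_def product_isomorphism_rel_def
  by (auto intro: algebra_isomorphic_refl algebra_isomorphic_sym vec.vector_space_axioms
           dest: algebra_isomorphic_trans)

lemma idempotent_evolution_algebra_has_coordinate_model:
  fixes smul :: "'a::field \<Rightarrow> 'v::ab_group_add \<Rightarrow> 'v"
  assumes E: "evolution_algebra CARD('n::finite) smul prd" and I: "idempotent_algebra smul prd"
  shows "\<exists>m \<in> (idempotent_evolution_products :: ('a ^ 'n \<Rightarrow> 'a ^ 'n \<Rightarrow> 'a ^ 'n) set).
           algebra_isomorphic smul prd (*s) m"
proof -
  let ?N = "{1..CARD('n)}"
  obtain e where e: "natural_basis CARD('n) smul prd e"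
    using E by (auto simp: evolution_algebra_def)
  have vs: "vector_space smul"
    and mr: "\<And>x. Vector_Spaces.linear smul smul (\<lambda>y. prd x y)"
    and ml: "\<And>y. Vector_Spaces.linear smul smul (\<lambda>x. prd x y)"
    using E by (auto simp: evolution_algebra_def is_algebra_def)
  interpret V: vector_space smul by (rule vs)
  interpret p: vector_space_pair smul "(*s) :: 'a \<Rightarrow> 'a ^ 'n \<Rightarrow> 'a ^ 'n" by unfold_locales
  have e': "inj_on e ?N" "V.independent (e ` ?N)" "V.span (e ` ?N) = UNIV"
    "\<And>i j. i \<in> ?N \<Longrightarrow> j \<in> ?N \<Longrightarrow> i \<noteq> j \<Longrightarrow> prd (e i) (e j) = 0"
    using e by (auto simp: natural_basis_def)
  have card: "card (e ` ?N) = card (cart_basis :: ('a ^ 'n) set)"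
    using e'(1) by (simp add: card_image card_cart_basis)
  have dimV: "card (e ` ?N) = V.dim UNIV"
    by (rule V.basis_card_eq_dim) (use e' in auto)
  have dimW: "card (cart_basis :: ('a ^ 'n) set) = vec.dim (UNIV :: ('a ^ 'n) set)"
    by (rule vec.basis_card_eq_dim) (auto simp: independent_cart_basis)
  obtain f where f: "Vector_Spaces.linear smul ((*s) :: 'a \<Rightarrow> 'a ^ 'n \<Rightarrow> 'a ^ 'n) f"
      "f ` UNIV = UNIV" "inj_on f UNIV"
    using p.finite_basis_to_basis_subspace_isomorphism[OF V.subspace_UNIV vec.subspace_UNIV
        trans[OF trans[OF dimV[symmetric] card] dimW] _ _ e'(2) _ dimV
        finite_cart_basis _ independent_cart_basis _ dimW] e'(3)
    by (metis finite_atLeastAtMost finite_imageI order_refl span_cart_basis subset_UNIV)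
  have bij: "bij f" using f by (simp add: bij_def)
  define g where "g = inv f"
  have gl: "Vector_Spaces.linear ((*s) :: 'a \<Rightarrow> 'a ^ 'n \<Rightarrow> 'a ^ 'n) smul g"
    unfolding g_def by (rule linear_inv_if_bij[OF f(1) bij])
  have gf: "g (f x) = x" for x using bij by (simp add: g_def bij_is_inj)
  have fg: "f (g y) = y" for y using bij by (simp add: g_def bij_is_surj surj_f_inv_f)
  interpret F: Vector_Spaces.linear smul "(*s) :: 'a \<Rightarrow> 'a ^ 'n \<Rightarrow> 'a ^ 'n" f by (rule f(1))
  define m where "m = (\<lambda>x y. f (prd (g x) (g y)))"
  have "Vector_Spaces.linear ((*s) :: 'a \<Rightarrow> 'a ^ 'n \<Rightarrow> 'a ^ 'n) (*s) (m x)" for x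
    using Vector_Spaces.linear_compose[OF Vector_Spaces.linear_compose[OF gl mr] f(1)]
    by (simp add: m_def o_def)
  moreover have "Vector_Spaces.linear ((*s) :: 'a \<Rightarrow> 'a ^ 'n \<Rightarrow> 'a ^ 'n) (*s) (\<lambda>x. m x y)" for y
    using Vector_Spaces.linear_compose[OF Vector_Spaces.linear_compose[OF gl ml] f(1)]
    by (simp add: m_def o_def)
  ultimately have alg: "is_algebra ((*s) :: 'a \<Rightarrow> 'a ^ 'n \<Rightarrow> 'a ^ 'n) m"
    by (simp add: is_algebra_def vec.vector_space_axioms)
  have "natural_basis CARD('n) (*s) m (f \<circ> e)"
    unfolding natural_basis_def
  proof (intro conjI ballI impI)
    show "inj_on (f \<circ> e) ?N"
      using e'(1) f(3) by (auto intro!: comp_inj_on inj_on_subset[OF f(3)])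
    show "vec.independent ((f \<circ> e) ` ?N)"
      using F.independent_inj_image[OF e'(2) f(3)] by (simp add: image_comp)
    show "vec.span ((f \<circ> e) ` ?N) = UNIV"
      using F.span_image[of "e ` ?N"] e'(3) f(2) by (simp add: image_comp)
    show "m ((f \<circ> e) i) ((f \<circ> e) j) = 0" if "i \<in> ?N" "j \<in> ?N" "i \<noteq> j" for i j
      using e'(4)[OF that] by (simp add: m_def gf F.zero)
  qed
  moreover have "vec.span {m x y | x y. True} = UNIV"
  proof -
    have "{m x y | x y. True} = f ` {prd x y | x y. True}"
      unfolding m_def by (auto simp: image_iff) (metis gf)
    then show ?thesis
      using F.span_image[of "{prd x y | x y. True}"] I f(2) by (simp add: idempotent_algebra_def)
  qed
  ultimately have "m \<in> idempotent_evolution_products"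
    using alg
    by (auto simp: idempotent_evolution_products_def evolution_algebra_def idempotent_algebra_def)
  moreover have "algebra_isomorphic smul prd (*s) m"
    unfolding algebra_isomorphic_def m_def using f(1) bij gf by auto
  ultimately show ?thesis by blast
qed

end

theory Submission
  imports Defs "HOL-Computational_Algebra.Polynomial" "HOL-Number_Theory.Residues"
begin

text \<open>
  In a natural basis an evolution algebra of dimension two is given by the four structure constants
  of \<open>e\<^sub>1\<^sup>2 = a e\<^sub>1 + b e\<^sub>2\<close> and \<open>e\<^sub>2\<^sup>2 = c e\<^sub>1 + d e\<^sub>2\<close>, and it is idempotent exactly when \<open>a d \<noteq> b c\<close>. In the
  idempotent case the natural basis is unique up to scaling and order, because two nonzero vectors
  with product zero must lie on different axes (\<open>isomorphic_laws_iff\<close>). Isomorphism classes are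
  therefore the orbits of the scalings \<open>(a, b, c, d) \<mapsto> (s a, s\<^sup>2 b / t, t\<^sup>2 c / s, t d)\<close> and of the
  exchange \<open>(a, b, c, d) \<mapsto> (d, c, b, a)\<close> on nonsingular quadruples.

  The orbits fall into three families, according to how many of \<open>a\<close> and \<open>d\<close> vanish.

   \<^item> If neither vanishes, scaling makes both equal to \<open>1\<close>; what remains is the unordered pair of the
     other two entries, subject to \<open>x y \<noteq> 1\<close>. There are \<open>(q\<^sup>2 - q + 1 + q - \<epsilon>) / 2\<close> such pairs, where
     \<open>\<epsilon>\<close> is the number of square roots of \<open>1\<close>: one in characteristic two, and two otherwise.
   \<^item> If exactly one vanishes, the normal form is \<open>(1, 1, u, 0)\<close> with \<open>u \<noteq> 0\<close>, which gives \<open>q - 1\<close>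
     orbits.
   \<^item> If both vanish, the normal form is \<open>(0, r, 1, 0)\<close>, where \<open>r \<noteq> 0\<close> is determined up to cubes and
     inversion. The nonzero elements modulo cubes have order \<open>3\<close> if \<open>3\<close> divides \<open>q - 1\<close>, and order
     \<open>1\<close> otherwise; modulo inversion this leaves two orbits or one
     (\<open>cube_classes_up_to_inversion\<close>, \<open>card_cube_classes\<close>).

  The function \<open>law_invariant\<close> records the family and the remaining parameter. It separates
  isomorphism classes (\<open>isomorphic_iff_law_invariant_eq\<close>), so the number of classes is the size of
  its image, and the three contributions add up to
  \<open>((q + 1)\<^sup>2 - \<epsilon>) / 2\<close>, plus \<open>1\<close> if \<open>3\<close> divides \<open>q - 1\<close>.
\<close>

section \<open>Cubes in a finite field\<close>

text \<open>
  Lagrange's theorem for the multiplicative group: multiplication by \<open>x\<close> permutes the nonzero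
  elements, so their product \<open>P\<close> satisfies \<open>P = x\<^bsup>q - 1\<^esup> P\<close>.
\<close>

lemma finite_field_unit_power_eq_1:
  fixes x :: "'a::{field, finite}"
  assumes "x \<noteq> 0"
  shows "x ^ (CARD('a) - 1) = 1"
proof -
  have "(\<Prod>y\<in>UNIV - {0}. x * y) = \<Prod>(UNIV - {0})"
    by (rule prod.reindex_bij_witness[of _ "\<lambda>y. y / x" "\<lambda>y. x * y"]) (use assms in auto)
  moreover have "(\<Prod>y\<in>UNIV - {0}. x * y) = x ^ (CARD('a) - 1) * \<Prod>(UNIV - {0})"
    by (simp add: prod.distrib card_Diff_singleton)
  moreover have "\<Prod>(UNIV - {0 :: 'a}) \<noteq> 0"
    by simp
  ultimately show ?thesis
    by simp
qed

lemma card_roots_of_unity_le: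
  assumes "0 < n"
  shows "card {x :: 'a::{comm_ring_1, ring_no_zero_divisors}. x ^ n = 1} \<le> n"
proof -
  define p :: "'a poly" where "p = Polynomial.monom 1 n - 1"
  have deg: "degree p = n"
    unfolding p_def using assms by (subst diff_conv_add_uminus, subst degree_add_eq_left) (auto simp: degree_monom_eq)
  then have "p \<noteq> 0"
    using assms by auto
  then show ?thesis
    using card_poly_roots_bound[of p] by (simp add: deg) (simp add: p_def poly_monom)
qed

text \<open>
  For \<open>x \<noteq> 0\<close>, write \<open>q - 1\<close> as \<open>3 k + 1\<close> or \<open>3 k + 2\<close>: then \<open>x\<^bsup>q - 1\<^esup> = 1\<close> makes \<open>x\<^bsup>-k\<^esup>\<close> or
  \<open>x\<^bsup>k + 1\<^esup>\<close>, respectively, a cube root of \<open>x\<close>.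
\<close>

lemma all_cubes_if_not_3_dvd:
  fixes x :: "'a::{field, finite}"
  assumes "\<not> 3 dvd (CARD('a) - 1)"
  shows "\<exists>z. x = z ^ 3"
proof (cases "x = 0")
  case False
  let ?n = "CARD('a) - 1" and ?k = "(CARD('a) - 1) div 3"
  have x1: "x ^ ?n = 1"
    by (rule finite_field_unit_power_eq_1[OF False])
  have "?n mod 3 = 1 \<or> ?n mod 3 = 2"
    using assms by (simp add: dvd_eq_mod_eq_0) linarith
  then consider "?n = ?k * 3 + 1" | "?n = ?k * 3 + 2"
    by (metis div_mult_mod_eq)
  then show ?thesis
  proof cases
    case 1
    have "x * (x ^ ?k) ^ 3 = x ^ (?k * 3 + 1)"
      by (simp add: power_mult)
    also have "\<dots> = 1"
      using 1 x1 by metis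
    finally have "x = inverse (x ^ ?k) ^ 3"
      using False by (simp add: field_simps)
    then show ?thesis ..
  next
    case 2
    have "(x ^ (?k + 1)) ^ 3 = x * x ^ (?k * 3 + 2)"
      by (simp add: power_mult power_mult_distrib power2_eq_square power3_eq_cube mult_ac)
    also have "\<dots> = x"
      using 2 x1 by (metis mult.right_neutral)
    finally show ?thesis
      by metis
  qed
qed (auto intro: exI[of _ 0])

text \<open>
  Let \<open>q - 1 = 3 k\<close>. Nonzero cubes satisfy \<open>x\<^sup>k = 1\<close>, an equation with at most \<open>k\<close> solutions. Conversely, cubing
  is at most three-to-one on the \<open>3 k\<close> nonzero elements, because \<open>1\<close> has at most three cube roots, so
  there are at least \<open>k\<close> nonzero cubes. Hence the nonzero cubes are exactly the solutions.
\<close>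

lemma cubes_if_3_dvd:
  fixes x :: "'a::{field, finite}"
  assumes "3 dvd (CARD('a) - 1)"
  defines "k \<equiv> (CARD('a) - 1) div 3"
  shows "x \<noteq> 0 \<Longrightarrow> (\<exists>z. x = z ^ 3) \<longleftrightarrow> x ^ k = 1"
    and "\<exists>x :: 'a. \<not> (\<exists>z. x = z ^ 3)"
proof -
  let ?U = "UNIV - {0 :: 'a}" and ?K = "{x :: 'a. x ^ k = 1}"
  let ?C = "(\<lambda>z. z ^ 3) ` ?U"
  have n: "CARD('a) - 1 = 3 * k"
    using assms(1) unfolding k_def by (metis dvd_mult_div_cancel)
  have "card {0, 1 :: 'a} \<le> CARD('a)"
    by (rule card_mono) auto
  then have "0 < k"
    using n by simp
  have U: "card ?U = 3 * k"
    using n by (simp add: card_Diff_singleton)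
  have K: "card ?K \<le> k"
    by (rule card_roots_of_unity_le[OF \<open>0 < k\<close>])
  have CK: "?C \<subseteq> ?K"
  proof
    fix x assume "x \<in> ?C"
    then obtain z where "z \<noteq> 0" "x = z ^ 3" by auto
    then have "x ^ k = z ^ (CARD('a) - 1)"
      unfolding n by (simp add: power_mult)
    then show "x \<in> ?K"
      using finite_field_unit_power_eq_1[OF \<open>z \<noteq> 0\<close>] by simp
  qed
  have fibre: "card {z \<in> ?U. z ^ 3 = y} \<le> 3" if y: "y \<in> ?C" for y
  proof -
    obtain z0 where z0: "z0 \<noteq> 0" "y = z0 ^ 3"
      using y by auto
    have "card {z \<in> ?U. z ^ 3 = y} \<le> card {w :: 'a. w ^ 3 = 1}"
      by (rule card_inj_on_le[of "\<lambda>z. z / z0"]) (use z0 in \<open>auto simp: inj_on_def power_divide\<close>)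
    also have "\<dots> \<le> 3"
      by (rule card_roots_of_unity_le) simp
    finally show ?thesis .
  qed
  have "card ?U = card (\<Union>y\<in>?C. {z \<in> ?U. z ^ 3 = y})"
    by (rule arg_cong[where f = card]) auto
  also have "\<dots> \<le> (\<Sum>y\<in>?C. card {z \<in> ?U. z ^ 3 = y})"
    by (rule card_UN_le) simp
  also have "\<dots> \<le> (\<Sum>y\<in>?C. 3)"
    by (rule sum_mono) (rule fibre)
  finally have "k \<le> card ?C"
    using U by simp
  then have eq: "?C = ?K"
    using K CK by (intro card_seteq) auto
  show "(\<exists>z. x = z ^ 3) \<longleftrightarrow> x ^ k = 1" if "x \<noteq> 0"
  proof -
    have "(\<exists>z. x = z ^ 3) \<longleftrightarrow> x \<in> ?C"
      using that by (auto simp: image_iff)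
    then show ?thesis
      using eq by simp
  qed
  have "card ?K < card ?U"
    using K U \<open>0 < k\<close> by simp
  then have "\<not> ?U \<subseteq> ?K"
    by (metis card_mono finite not_le)
  then obtain x where "x \<in> ?U" "x \<notin> ?C"
    using eq by blast
  then show "\<exists>x :: 'a. \<not> (\<exists>z. x = z ^ 3)"
    by (intro exI[of _ x]) (auto simp: image_iff)
qed

text \<open>
  The nonzero elements modulo cubes form a group of order \<open>1\<close> or \<open>3\<close>, and inversion interchanges the
  two nontrivial elements of a group of order \<open>3\<close>. So an element is determined, up to a cube and
  inversion, by whether it is a cube.
\<close>

lemma cube_classes_up_to_inversion:
  fixes c d :: "'a::{field, finite}"
  assumes "c \<noteq> 0" "d \<noteq> 0" and iff: "(\<exists>z. c = z ^ 3) \<longleftrightarrow> (\<exists>z. d = z ^ 3)"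
  shows "\<exists>w. w \<noteq> 0 \<and> (c = d * w ^ 3 \<or> c * d = w ^ 3)"
proof -
  have "(\<exists>z. c / d = z ^ 3) \<or> (\<exists>z. c * d = z ^ 3)"
  proof (cases "\<exists>z. c = z ^ 3")
    case True
    then obtain u v where "c = u ^ 3" "d = v ^ 3"
      using iff by auto
    then have "c * d = (u * v) ^ 3"
      by (simp add: power_mult_distrib)
    then show ?thesis by blast
  next
    case False
    then have "3 dvd (CARD('a) - 1)"
      using all_cubes_if_not_3_dvd by blast
    note cubes = cubes_if_3_dvd(1)[OF this]
    define k where "k = (CARD('a) - 1) div 3"
    have "y ^ k * y ^ k * y ^ k = 1" if "y \<noteq> 0" for y :: 'a
    proof -
      have "y ^ k * y ^ k * y ^ k = y ^ (3 * k)"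
        by (simp add: power_mult power3_eq_cube mult.commute[of 3])
      then show ?thesis
        using finite_field_unit_power_eq_1[OF that] \<open>3 dvd (CARD('a) - 1)\<close> by (simp add: k_def)
    qed
    then have c3: "c ^ k * c ^ k * c ^ k = 1" and d3: "d ^ k * d ^ k * d ^ k = 1"
      using assms by auto
    have c1: "c ^ k \<noteq> 1" and d1: "d ^ k \<noteq> 1"
      using False iff cubes[of c] cubes[of d] assms(1,2) by (auto simp: k_def)
    \<comment> \<open>Both powers are roots of \<open>X\<^sup>2 + X + 1\<close>, hence equal or inverse to each other.\<close>
    have "(c ^ k - 1) * (c ^ k * c ^ k + c ^ k + 1) = 0" "(d ^ k - 1) * (d ^ k * d ^ k + d ^ k + 1) = 0"
      using c3 d3 by (simp_all add: algebra_simps)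
    then have "c ^ k * c ^ k + c ^ k + 1 = 0" "d ^ k * d ^ k + d ^ k + 1 = 0"
      using c1 d1 by auto
    moreover have "(c ^ k - d ^ k) * (c ^ k * d ^ k - 1) =
        d ^ k * (c ^ k * c ^ k + c ^ k + 1) - c ^ k * (d ^ k * d ^ k + d ^ k + 1)"
      by (simp add: algebra_simps)
    ultimately have "(c ^ k - d ^ k) * (c ^ k * d ^ k - 1) = 0"
      by simp
    then have "(c / d) ^ k = 1 \<or> (c * d) ^ k = 1"
      using assms by (auto simp: power_divide power_mult_distrib)
    then show ?thesis
      using cubes[of "c / d"] cubes[of "c * d"] assms(1,2) by (auto simp: k_def)
  qed
  then show ?thesis
  proof (elim disjE exE)
    fix z assume "c / d = z ^ 3"
    then show ?thesis
      using assms(1,2) by (intro exI[of _ z]) (auto simp: field_simps)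
  next
    fix z assume "c * d = z ^ 3"
    then show ?thesis
      using assms(1,2) by (intro exI[of _ z]) auto
  qed
qed

section \<open>Counting unordered pairs and equivalence classes\<close>

text \<open>
  An unordered pair has two orderings unless its two members agree.
\<close>

lemma card_unordered_pairs:
  assumes fin: "finite D" and sym: "\<And>x y. (x, y) \<in> D \<Longrightarrow> (y, x) \<in> D"
  shows "2 * card ((\<lambda>(x, y). {x, y}) ` D) = card D + card {x. (x, x) \<in> D}"
proof -
  \<comment> \<open>An injection into the naturals picks one ordered pair from each unordered one.\<close>
  have "finite (fst ` D)"
    using fin by simp
  then obtain h :: "'a \<Rightarrow> nat" where h: "inj_on h (fst ` D)"
    using finite_imp_inj_to_nat_seg by meson
  have h_eq: "x = y" if "(x, y) \<in> D" "h x = h y" for x y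
    using inj_onD[OF h that(2)] that(1) sym[OF that(1)] by force
  let ?R = "{(x, y) \<in> D. h x \<le> h y}" and ?R' = "{(x, y) \<in> D. h y \<le> h x}"
  have finR: "finite ?R" "finite ?R'"
    using fin by (auto intro: finite_subset[of _ D])
  have "card ?R' = card ?R"
    by (rule bij_betw_same_card[of prod.swap], rule bij_betwI[where g = prod.swap]) (auto intro: sym)
  moreover have "?R \<union> ?R' = D"
    by auto
  moreover have "?R \<inter> ?R' = (\<lambda>x. (x, x)) ` {x. (x, x) \<in> D}"
  proof (intro equalityI subsetI)
    fix p assume "p \<in> ?R \<inter> ?R'"
    then obtain x y where "p = (x, y)" "(x, y) \<in> D" "h x = h y"
      by auto
    with h_eq[of x y] show "p \<in> (\<lambda>x. (x, x)) ` {x. (x, x) \<in> D}"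
      by auto
  qed auto
  then have "card (?R \<inter> ?R') = card {x. (x, x) \<in> D}"
    by (simp add: card_image inj_on_def)
  moreover have "card ((\<lambda>(x, y). {x, y}) ` D) = card ?R"
  proof -
    have "(\<lambda>(x, y). {x, y}) ` D = (\<lambda>(x, y). {x, y}) ` ?R"
    proof (intro equalityI subsetI)
      fix s assume "s \<in> (\<lambda>(x, y). {x, y}) ` D"
      then obtain x y where s: "(x, y) \<in> D" "s = {x, y}"
        by auto
      show "s \<in> (\<lambda>(x, y). {x, y}) ` ?R"
      proof (cases "h x \<le> h y")
        case True
        then show ?thesis using s by (intro image_eqI[of _ _ "(x, y)"]) auto
      next
        case False
        then show ?thesis using s sym[of x y] by (intro image_eqI[of _ _ "(y, x)"]) auto
      qed
    qed auto
    moreover have "inj_on (\<lambda>(x, y). {x, y}) ?R"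
      by (auto simp: inj_on_def doubleton_eq_iff intro: h_eq dest: h_eq)
    ultimately show ?thesis
      by (simp add: card_image)
  qed
  ultimately show ?thesis
    using card_Un_Int[OF finR] by simp
qed

text \<open>
  The models \<open>\<rho> k\<close> need only represent every class, possibly many times; the invariant is computed
  from the parameter \<open>k\<close>, not from the element \<open>\<rho> k\<close>. Classes of algebras can thus be counted through their
  structure constants.
\<close>

lemma card_quotient_by_complete_invariant:
  assumes eqv: "equiv A r"
    and in_A: "\<And>k. k \<in> K \<Longrightarrow> \<rho> k \<in> A"
    and covers: "\<And>x. x \<in> A \<Longrightarrow> \<exists>k\<in>K. (x, \<rho> k) \<in> r"
    and complete: "\<And>k l. k \<in> K \<Longrightarrow> l \<in> K \<Longrightarrow> (\<rho> k, \<rho> l) \<in> r \<longleftrightarrow> f k = f l"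
  shows "card (A // r) = card (f ` K)"
proof -
  have class_eq: "r `` {\<rho> k} = r `` {\<rho> l} \<longleftrightarrow> f k = f l" if "k \<in> K" "l \<in> K" for k l
    using eq_equiv_class_iff[OF eqv in_A in_A] complete that by metis
  have "A // r = (\<lambda>k. r `` {\<rho> k}) ` K"
  proof (intro equalityI subsetI)
    fix X assume "X \<in> A // r"
    then obtain x where "x \<in> A" "X = r `` {x}"
      by (auto elim: quotientE)
    moreover from this obtain k where "k \<in> K" "(x, \<rho> k) \<in> r"
      using covers by blast
    ultimately show "X \<in> (\<lambda>k. r `` {\<rho> k}) ` K"
      using equiv_class_eq[OF eqv] by blast
  qed (use in_A in \<open>auto intro: quotientI\<close>)
  also have "\<dots> = (\<lambda>v. r `` {\<rho> (inv_into K f v)}) ` f ` K"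
    unfolding image_image
    by (rule image_cong[OF refl], subst class_eq) (auto simp: f_inv_into_f inv_into_into)
  also have "card \<dots> = card (f ` K)"
    by (rule card_image, rule inj_onI, subst (asm) class_eq) (auto simp: f_inv_into_f inv_into_into)
  finally show ?thesis .
qed

section \<open>Products given by structure constants\<close>

text \<open>
  The evolution algebra on the plane in which the coordinate axes are a natural basis with
  \<open>e\<^sub>1\<^sup>2 = (a, b)\<close> and \<open>e\<^sub>2\<^sup>2 = (c, d)\<close>. The four scalars are the columns of the structure matrix.
\<close>

definition law ::
    "'a::field \<times> 'a \<times> 'a \<times> 'a \<Rightarrow> 'a ^ 2 \<Rightarrow> 'a ^ 2 \<Rightarrow> 'a ^ 2" where
  "law = (\<lambda>(a, b, c, d) x y.
     vector [a * (x $ 1 * y $ 1) + c * (x $ 2 * y $ 2), b * (x $ 1 * y $ 1) + d * (x $ 2 * y $ 2)])"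

definition nonsingular_laws :: "('a::field \<times> 'a \<times> 'a \<times> 'a) set" where
  "nonsingular_laws = {(a, b, c, d). a * d \<noteq> b * c}"

lemma law_nth:
  "law (a, b, c, d) x y $ 1 = a * (x $ 1 * y $ 1) + c * (x $ 2 * y $ 2)"
  "law (a, b, c, d) x y $ 2 = b * (x $ 1 * y $ 1) + d * (x $ 2 * y $ 2)"
  by (simp_all add: law_def)

lemma vec2_eq_iff: "x = y \<longleftrightarrow> x $ 1 = y $ 1 \<and> x $ 2 = y $ 2" for x y :: "'a ^ 2"
  by (simp add: vec_eq_iff forall_2)

lemma linear_vecI:
  fixes f :: "'a::field ^ 'n \<Rightarrow> 'a ^ 'm"
  assumes "\<And>x y. f (x + y) = f x + f y" and "\<And>k x. f (k *s x) = k *s f x"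
  shows "Vector_Spaces.linear (*s) (*s) f"
  using assms by (intro Vector_Spaces.linear.intro module_hom.intro module_hom_axioms.intro
    vec.vector_space_axioms vec.module_axioms)

lemma is_algebra_law: "is_algebra (*s) (law M)"
proof -
  obtain a b c d where M: "M = (a, b, c, d)"
    by (cases M)
  have "Vector_Spaces.linear (*s) (*s) (law M x)" for x
    by (rule linear_vecI) (simp_all add: M vec2_eq_iff law_nth algebra_simps)
  moreover have "Vector_Spaces.linear (*s) (*s) (\<lambda>x. law M x y)" for y
    by (rule linear_vecI) (simp_all add: M vec2_eq_iff law_nth algebra_simps)
  ultimately show ?thesis
    by (simp add: is_algebra_def vec.vector_space_axioms)
qed

lemma natural_basis_law:
  "natural_basis 2 (*s) (law M) (\<lambda>i. if i = 1 then axis 1 1 else axis 2 1)"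
proof -
  let ?e = "\<lambda>i :: nat. if i = 1 then axis 1 1 else axis 2 1 :: 'a::field ^ 2"
  obtain a b c d where M: "M = (a, b, c, d)"
    by (cases M)
  have I: "{1..2 :: nat} = {1, 2}"
    by auto
  have img: "?e ` {1..2} = cart_basis"
    unfolding I cart_basis_def by (auto simp: exhaust_2) (metis exhaust_2)
  have inj: "inj_on ?e {1..2}"
    unfolding I by (auto simp: inj_on_def axis_eq_axis)
  have "law M (?e i) (?e j) = 0" if "i \<in> {1..2}" "j \<in> {1..2}" "i \<noteq> j" for i j
    using that unfolding I by (auto simp: M vec2_eq_iff law_nth axis_def)
  then show ?thesis
    unfolding natural_basis_def img using inj
    by (simp add: independent_cart_basis)
qed

text \<open>
  All products are linear combinations of the two squares \<open>(a, b)\<close> and \<open>(c, d)\<close>, so they span the plane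
  exactly when these squares are linearly independent.
\<close>

lemma idempotent_law_iff: "idempotent_algebra (*s) (law M) \<longleftrightarrow> M \<in> nonsingular_laws"
proof -
  obtain a b c d where M: "M = (a, b, c, d)"
    by (cases M)
  show ?thesis
  proof
    assume idem: "idempotent_algebra (*s) (law M)"
    show "M \<in> nonsingular_laws"
    proof (rule ccontr)
      assume "M \<notin> nonsingular_laws"
      then have sing: "a * d = b * c"
        by (simp add: M nonsingular_laws_def)
      \<comment> \<open>A linear form that vanishes on both squares \<open>(a, b)\<close> and \<open>(c, d)\<close>.\<close>
      obtain p q where pq: "p * a + q * b = 0" "p * c + q * d = 0" "p \<noteq> 0 \<or> q \<noteq> 0"
      proof (cases "a = 0 \<and> b = 0")
        case True
        show ?thesis
        proof (cases "c = 0 \<and> d = 0")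
          case True
          then show ?thesis using that[of 1 0] \<open>a = 0 \<and> b = 0\<close> by simp
        next
          case False
          then show ?thesis using that[of d "- c"] \<open>a = 0 \<and> b = 0\<close> by auto
        qed
      next
        case False
        then show ?thesis using that[of b "- a"] sing by (auto simp: algebra_simps)
      qed
      let ?H = "{x :: 'a ^ 2. p * x $ 1 + q * x $ 2 = 0}"
      have "vec.subspace ?H"
      proof (rule vec.subspaceI)
        fix k and x :: "'a ^ 2" assume "x \<in> ?H"
        moreover have "p * (k *s x) $ 1 + q * (k *s x) $ 2 = k * (p * x $ 1 + q * x $ 2)"
          by (simp add: algebra_simps)
        ultimately show "k *s x \<in> ?H"
          by simp
      next
        fix x y :: "'a ^ 2" assume "x \<in> ?H" "y \<in> ?H"
        moreover have "p * (x + y) $ 1 + q * (x + y) $ 2 =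
            (p * x $ 1 + q * x $ 2) + (p * y $ 1 + q * y $ 2)"
          by (simp add: algebra_simps)
        ultimately show "x + y \<in> ?H"
          by simp
      qed simp
      moreover have "law M x y \<in> ?H" for x y
      proof -
        have "p * law M x y $ 1 + q * law M x y $ 2 =
            (p * a + q * b) * (x $ 1 * y $ 1) + (p * c + q * d) * (x $ 2 * y $ 2)"
          by (simp add: M law_nth algebra_simps)
        then show ?thesis
          using pq by simp
      qed
      ultimately have "vec.span {law M x y | x y. True} \<subseteq> ?H"
        by (intro vec.span_minimal) auto
      then have "?H = UNIV"
        using idem by (auto simp: idempotent_algebra_def)
      then have "vector [1, 0] \<in> ?H" "vector [0, 1] \<in> ?H"
        by auto
      then show False
        using pq(3) by simp
    qed
  next
    assume "M \<in> nonsingular_laws"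
    then have det: "a * d - b * c \<noteq> 0"
      by (simp add: M nonsingular_laws_def)
    \<comment> \<open>Cramer's rule writes every vector as a single product with \<open>(1, 1)\<close>.\<close>
    have "x \<in> {law M x y | x y. True}" for x
    proof -
      let ?D = "a * d - b * c"
      let ?u = "vector [(d * x $ 1 - c * x $ 2) / ?D, (a * x $ 2 - b * x $ 1) / ?D] :: 'a ^ 2"
      have "(a * (d * x $ 1 - c * x $ 2) + c * (a * x $ 2 - b * x $ 1)) / ?D = x $ 1"
        "(b * (d * x $ 1 - c * x $ 2) + d * (a * x $ 2 - b * x $ 1)) / ?D = x $ 2"
        using det by (simp_all add: divide_eq_eq) (simp_all add: algebra_simps)
      then have "x = law M ?u (vector [1, 1])"
        by (simp add: M vec2_eq_iff law_nth add_divide_distrib)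
      then show ?thesis
        by blast
    qed
    then have "{law M x y | x y. True} = UNIV"
      by blast
    then show "idempotent_algebra (*s) (law M)"
      by (simp add: idempotent_algebra_def)
  qed
qed

lemma law_in_products_iff:
  "law M \<in> idempotent_evolution_products \<longleftrightarrow> M \<in> nonsingular_laws"
  using natural_basis_law[of M]
  by (auto simp: idempotent_evolution_products_def evolution_algebra_def is_algebra_law
      idempotent_law_iff)

lemma idempotent_algebra_if_isomorphic:
  fixes s1 :: "'a::field \<Rightarrow> 'v::ab_group_add \<Rightarrow> 'v" and s2 :: "'a \<Rightarrow> 'w::ab_group_add \<Rightarrow> 'w"
  assumes "algebra_isomorphic s1 m1 s2 m2" and idem: "idempotent_algebra s1 m1"
  shows "idempotent_algebra s2 m2"
proof -
  obtain f where f: "Vector_Spaces.linear s1 s2 f" "bij f" "\<And>x y. f (m1 x y) = m2 (f x) (f y)"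
    using assms(1) by (auto simp: algebra_isomorphic_def)
  interpret F: Vector_Spaces.linear s1 s2 f
    by (rule f(1))
  have "{m2 x y | x y. True} = f ` {m1 x y | x y. True}"
    using f(2,3) by (auto simp: image_iff) (metis bij_pointE)
  then show ?thesis
    using F.span_image[of "{m1 x y | x y. True}"] idem bij_is_surj[OF f(2)]
    by (simp add: idempotent_algebra_def)
qed

text \<open>
  Coordinates with respect to a natural basis \<open>u, v\<close> turn the given product into one described by
  structure constants: the map \<open>x \<mapsto> x\<^sub>1 u + x\<^sub>2 v\<close> is bijective, and \<open>u v = v u = 0\<close> leaves only the
  squares of \<open>u\<close> and \<open>v\<close>.
\<close>

lemma evolution_product_has_law:
  fixes m :: "'a::field ^ 2 \<Rightarrow> 'a ^ 2 \<Rightarrow> 'a ^ 2"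
  assumes "evolution_algebra 2 (*s) m"
  shows "\<exists>M. algebra_isomorphic (*s) m (*s) (law M)"
proof -
  obtain e where e: "natural_basis 2 (*s) m e"
    using assms by (auto simp: evolution_algebra_def)
  define u v where "u = e 1" and "v = e 2"
  have I: "{1..2 :: nat} = {1, 2}"
    by auto
  have uv: "u \<noteq> v" "vec.independent {u, v}" "vec.span {u, v} = UNIV" "m u v = 0" "m v u = 0"
    using e unfolding natural_basis_def I by (simp_all add: u_def v_def)
  have lin: "Vector_Spaces.linear (*s) (*s) (m x)" "Vector_Spaces.linear (*s) (*s) (\<lambda>x. m x y)" for x y
    using assms by (auto simp: evolution_algebra_def is_algebra_def)
  define \<phi> where "\<phi> = (\<lambda>x :: 'a ^ 2. x $ 1 *s u + x $ 2 *s v)"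
  have lin\<phi>: "Vector_Spaces.linear (*s) (*s) \<phi>"
    by (rule linear_vecI) (simp_all add: \<phi>_def vec2_eq_iff algebra_simps)
  interpret \<Phi>: Vector_Spaces.linear "(*s)" "(*s)" \<phi>
    by (rule lin\<phi>)
  have surj: "\<exists>x. \<phi> x = w" for w
  proof -
    have "w \<in> vec.span (insert u {v})"
      using uv(3) by auto
    then obtain k where "w - k *s u \<in> vec.span {v}"
      by (auto simp: vec.span_insert)
    then obtain l where "w - k *s u = l *s v"
      by (auto simp: vec.span_singleton)
    then have "\<phi> (vector [k, l]) = w"
      by (simp add: \<phi>_def algebra_simps)
    then show ?thesis ..
  qed
  have "u \<notin> vec.span {v}" "v \<noteq> 0"
    using uv(1,2) by (auto simp: vec.independent_insert)
  have "x = 0" if "\<phi> x = 0" for x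
  proof -
    have eq: "x $ 1 *s u = - (x $ 2) *s v"
      using that by (simp add: \<phi>_def eq_neg_iff_add_eq_0)
    have "x $ 1 = 0"
    proof (rule ccontr)
      assume "x $ 1 \<noteq> 0"
      then have "u = inverse (x $ 1) *s (x $ 1 *s u)"
        by simp
      also have "\<dots> \<in> vec.span {v}"
        unfolding eq by (intro vec.span_scale vec.span_base) simp
      finally show False
        using \<open>u \<notin> vec.span {v}\<close> by simp
    qed
    moreover from this have "x $ 2 = 0"
      using eq \<open>v \<noteq> 0\<close> by simp
    ultimately show ?thesis
      by (simp add: vec2_eq_iff)
  qed
  then have "inj \<phi>"
    by (simp add: \<Phi>.inj_iff_eq_0)
  with surj have bij: "bij \<phi>"
    unfolding bij_def surj_def by metis
  obtain x where x: "\<phi> x = m u u" using surj by blast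
  obtain y where y: "\<phi> y = m v v" using surj by blast
  let ?M = "(x $ 1, x $ 2, y $ 1, y $ 2)"
  have "\<phi> (law ?M w z) = m (\<phi> w) (\<phi> z)" for w z
  proof -
    interpret R: Vector_Spaces.linear "(*s)" "(*s)" "m p" for p
      by (rule lin)
    interpret L: Vector_Spaces.linear "(*s)" "(*s)" "\<lambda>x. m x p" for p
      by (rule lin)
    have "m (\<phi> w) (\<phi> z) = (w $ 1 * z $ 1) *s m u u + (w $ 2 * z $ 2) *s m v v"
      by (simp add: \<phi>_def R.add R.scale L.add L.scale uv(4,5) mult.commute)
    also have "\<dots> = \<phi> (law ?M w z)"
      by (simp add: x[symmetric] y[symmetric]) (simp add: \<phi>_def vec2_eq_iff law_nth algebra_simps)
    finally show ?thesis ..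
  qed
  then have "algebra_isomorphic (*s) (law ?M) (*s) m"
    unfolding algebra_isomorphic_def using lin\<phi> bij by blast
  then show ?thesis
    using algebra_isomorphic_sym by blast
qed

text \<open>
  The structure constants of the same algebra in the natural basis \<open>s e\<^sub>1, t e\<^sub>2\<close>.
\<close>

fun rescale :: "'a::field \<Rightarrow> 'a \<Rightarrow> 'a \<times> 'a \<times> 'a \<times> 'a \<Rightarrow> 'a \<times> 'a \<times> 'a \<times> 'a" where
  "rescale s t (a, b, c, d) = (s * a, s\<^sup>2 * b / t, t\<^sup>2 * c / s, t * d)"

fun swap_axes :: "'a \<times> 'a \<times> 'a \<times> 'a \<Rightarrow> 'a \<times> 'a \<times> 'a \<times> 'a" where
  "swap_axes (a, b, c, d) = (d, c, b, a)"

lemma isomorphic_law_rescale: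
  fixes N :: "'a::field \<times> 'a \<times> 'a \<times> 'a"
  assumes "s \<noteq> 0" "t \<noteq> 0"
  shows "algebra_isomorphic (*s) (law (rescale s t N)) (*s) (law N)"
proof -
  obtain a b c d where N: "N = (a, b, c, d)"
    by (cases N)
  define f where "f = (\<lambda>x :: 'a ^ 2. vector [s * x $ 1, t * x $ 2] :: 'a ^ 2)"
  have "Vector_Spaces.linear (*s) (*s) f"
    by (rule linear_vecI) (simp_all add: f_def vec2_eq_iff algebra_simps)
  moreover have "bij f"
    by (rule o_bij[of "\<lambda>x. vector [x $ 1 / s, x $ 2 / t]"])
      (use assms in \<open>auto simp: f_def fun_eq_iff vec2_eq_iff\<close>)
  moreover have "f (law (rescale s t N) x y) = law N (f x) (f y)" for x y
    using assms by (simp add: N f_def vec2_eq_iff law_nth field_simps power2_eq_square)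
  ultimately show ?thesis
    unfolding algebra_isomorphic_def by blast
qed

lemma isomorphic_law_swap_axes:
  fixes N :: "'a::field \<times> 'a \<times> 'a \<times> 'a"
  shows "algebra_isomorphic (*s) (law (swap_axes N)) (*s) (law N)"
proof -
  obtain a b c d where N: "N = (a, b, c, d)"
    by (cases N)
  define f where "f = (\<lambda>x :: 'a ^ 2. vector [x $ 2, x $ 1] :: 'a ^ 2)"
  have "Vector_Spaces.linear (*s) (*s) f"
    by (rule linear_vecI) (simp_all add: f_def vec2_eq_iff)
  moreover have "bij f"
    by (rule o_bij[of f]) (auto simp: f_def fun_eq_iff vec2_eq_iff)
  moreover have "f (law (swap_axes N) x y) = law N (f x) (f y)" for x y
    by (simp add: N f_def vec2_eq_iff law_nth algebra_simps)
  ultimately show ?thesis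
    unfolding algebra_isomorphic_def by blast
qed

text \<open>
  In an idempotent evolution algebra of dimension two the natural basis is unique up to scaling and
  order. Indeed, an isomorphism sends the axes to nonzero vectors \<open>u, v\<close> with \<open>u v = 0\<close>; as the squares
  of the axes are independent, this means \<open>u\<^sub>1 v\<^sub>1 = u\<^sub>2 v\<^sub>2 = 0\<close>, so \<open>u\<close> and \<open>v\<close> lie on different axes.
\<close>

lemma isomorphic_laws_iff:
  fixes M N :: "'a::field \<times> 'a \<times> 'a \<times> 'a"
  assumes "N \<in> nonsingular_laws"
  shows "algebra_isomorphic (*s) (law M) (*s) (law N) \<longleftrightarrow>
    (\<exists>s t. s \<noteq> 0 \<and> t \<noteq> 0 \<and> (M = rescale s t N \<or> M = rescale s t (swap_axes N)))"
proof
  assume "algebra_isomorphic (*s) (law M) (*s) (law N)"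
  then obtain f where f: "Vector_Spaces.linear (*s) (*s) f" "bij f"
    and hom: "\<And>x y. f (law M x y) = law N (f x) (f y)"
    by (auto simp: algebra_isomorphic_def)
  interpret F: Vector_Spaces.linear "(*s)" "(*s)" f
    by (rule f(1))
  obtain a b c d where N: "N = (a, b, c, d)"
    by (cases N)
  obtain a' b' c' d' where M: "M = (a', b', c', d')"
    by (cases M)
  have det: "a * d - b * c \<noteq> 0"
    using assms by (simp add: nonsingular_laws_def N)
  define u v where "u = f (axis 1 1)" and "v = f (axis 2 1)"
  have "law M (axis 1 1) (axis 2 1) = 0" "law M (axis 1 1) (axis 1 1) = a' *s axis 1 1 + b' *s axis 2 1"
    "law M (axis 2 1) (axis 2 1) = c' *s axis 1 1 + d' *s axis 2 1"
    by (simp_all add: M vec2_eq_iff law_nth axis_def)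
  then have uv: "law N u v = 0" "law N u u = a' *s u + b' *s v" "law N v v = c' *s u + d' *s v"
    using hom[symmetric] by (simp_all add: u_def v_def F.zero F.add F.scale)
  have "u \<noteq> 0" "v \<noteq> 0"
    using bij_is_inj[OF f(2)] F.inj_iff_eq_0 by (auto simp: u_def v_def)
  \<comment> \<open>As \<open>N\<close> is nonsingular, \<open>u v = 0\<close> forces the coordinatewise product of \<open>u\<close> and \<open>v\<close> to vanish.\<close>
  have eqs: "a * (u $ 1 * v $ 1) + c * (u $ 2 * v $ 2) = 0" "b * (u $ 1 * v $ 1) + d * (u $ 2 * v $ 2) = 0"
    using uv(1) by (simp_all add: N vec2_eq_iff law_nth)
  have "(a * d - b * c) * (u $ 1 * v $ 1) =
      d * (a * (u $ 1 * v $ 1) + c * (u $ 2 * v $ 2)) - c * (b * (u $ 1 * v $ 1) + d * (u $ 2 * v $ 2))"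
    "(a * d - b * c) * (u $ 2 * v $ 2) =
      a * (b * (u $ 1 * v $ 1) + d * (u $ 2 * v $ 2)) - b * (a * (u $ 1 * v $ 1) + c * (u $ 2 * v $ 2))"
    by (simp_all add: algebra_simps)
  then have "u $ 1 = 0 \<or> v $ 1 = 0" "u $ 2 = 0 \<or> v $ 2 = 0"
    using eqs det by simp_all
  then consider "u $ 2 = 0" "v $ 1 = 0" "u $ 1 \<noteq> 0" "v $ 2 \<noteq> 0"
    | "u $ 1 = 0" "v $ 2 = 0" "u $ 2 \<noteq> 0" "v $ 1 \<noteq> 0"
    using \<open>u \<noteq> 0\<close> \<open>v \<noteq> 0\<close> by (auto simp: vec2_eq_iff)
  then show "\<exists>s t. s \<noteq> 0 \<and> t \<noteq> 0 \<and> (M = rescale s t N \<or> M = rescale s t (swap_axes N))"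
  proof cases
    case 1
    then have "M = rescale (u $ 1) (v $ 2) N"
      using uv(2,3) by (simp add: N M vec2_eq_iff law_nth field_simps power2_eq_square)
    then show ?thesis
      using 1 by blast
  next
    case 2
    then have "M = rescale (u $ 2) (v $ 1) (swap_axes N)"
      using uv(2,3) by (simp add: N M vec2_eq_iff law_nth field_simps power2_eq_square)
    then show ?thesis
      using 2 by blast
  qed
next
  assume "\<exists>s t. s \<noteq> 0 \<and> t \<noteq> 0 \<and> (M = rescale s t N \<or> M = rescale s t (swap_axes N))"
  then show "algebra_isomorphic (*s) (law M) (*s) (law N)"
    using isomorphic_law_rescale isomorphic_law_swap_axes algebra_isomorphic_trans by metis
qed

section \<open>A complete invariant\<close>

text \<open>
  The three summands of the type record whether both, exactly one or none of \<open>a\<close> and \<open>d\<close> are nonzero.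
  The values are the parameters that remain after scaling: \<open>{x, y}\<close> for the normal form
  \<open>(1, x, y, 1)\<close>, whose two parameters the exchange of axes swaps; \<open>u\<close> for \<open>(1, 1, u, 0)\<close>; and for
  \<open>(0, r, 1, 0)\<close>, where \<open>r\<close> matters only up to cubes and inversion, whether \<open>r\<close> is a cube.
\<close>

fun law_invariant :: "'a::field \<times> 'a \<times> 'a \<times> 'a \<Rightarrow> 'a set + 'a + bool" where
  "law_invariant (a, b, c, d) =
     (if a \<noteq> 0 \<and> d \<noteq> 0 then Inl {b * d / a\<^sup>2, a * c / d\<^sup>2}
      else if a \<noteq> 0 then Inr (Inl (b\<^sup>2 * c / a ^ 3))
      else if d \<noteq> 0 then Inr (Inl (c\<^sup>2 * b / d ^ 3))
      else Inr (Inr (\<exists>z. b / c = z ^ 3)))"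

lemma is_cube_mult_cube_iff:
  fixes x w :: "'a::field"
  assumes "w \<noteq> 0"
  shows "(\<exists>z. w ^ 3 * x = z ^ 3) \<longleftrightarrow> (\<exists>z. x = z ^ 3)"
proof
  assume "\<exists>z. w ^ 3 * x = z ^ 3"
  then obtain z where "w ^ 3 * x = z ^ 3" ..
  then have "x = (z / w) ^ 3"
    using assms by (simp add: power_divide eq_divide_eq mult.commute)
  then show "\<exists>z. x = z ^ 3" ..
next
  assume "\<exists>z. x = z ^ 3"
  then obtain z where "x = z ^ 3" ..
  then have "w ^ 3 * x = (w * z) ^ 3"
    by (simp add: power_mult_distrib)
  then show "\<exists>z. w ^ 3 * x = z ^ 3" ..
qed

lemma is_cube_inverse_iff:
  fixes x :: "'a::field"
  shows "(\<exists>z. inverse x = z ^ 3) \<longleftrightarrow> (\<exists>z. x = z ^ 3)"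
  by (metis inverse_inverse_eq power_inverse)

lemma law_invariant_rescale:
  assumes "s \<noteq> 0" "t \<noteq> 0"
  shows "law_invariant (rescale s t N) = law_invariant N"
proof -
  obtain a b c d where N: "N = (a, b, c, d)"
    by (cases N)
  have x: "s\<^sup>2 * b / t * (t * d) / (s * a)\<^sup>2 = b * d / a\<^sup>2"
    and y: "s * a * (t\<^sup>2 * c / s) / (t * d)\<^sup>2 = a * c / d\<^sup>2"
    using assms by (simp_all add: power_mult_distrib)
  have u: "(s\<^sup>2 * b / t)\<^sup>2 * (t\<^sup>2 * c / s) / (s * a) ^ 3 = b\<^sup>2 * c / a ^ 3"
    and v: "(t\<^sup>2 * c / s)\<^sup>2 * (s\<^sup>2 * b / t) / (t * d) ^ 3 = c\<^sup>2 * b / d ^ 3"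
    using assms by (simp_all add: power_mult_distrib power_divide power2_eq_square power3_eq_cube mult.assoc)
  have w: "s\<^sup>2 * b / t / (t\<^sup>2 * c / s) = (s / t) ^ 3 * (b / c)"
    using assms by (simp add: power_divide power2_eq_square power3_eq_cube mult_ac)
  have "(\<exists>z. s\<^sup>2 * b / t / (t\<^sup>2 * c / s) = z ^ 3) \<longleftrightarrow> (\<exists>z. b / c = z ^ 3)"
    unfolding w by (rule is_cube_mult_cube_iff) (use assms in simp)
  then show ?thesis
    unfolding N rescale.simps law_invariant.simps x y u v using assms by simp
qed

lemma law_invariant_swap_axes: "law_invariant (swap_axes N) = law_invariant N"
proof -
  obtain a b c d where N: "N = (a, b, c, d)"
    by (cases N)
  have "(\<exists>z. c / b = z ^ 3) \<longleftrightarrow> (\<exists>z. b / c = z ^ 3)"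
    using is_cube_inverse_iff[of "b / c"] by simp
  then show ?thesis
    by (simp add: N insert_commute mult.commute)
qed

abbreviation isomorphic_laws (infix "\<sim>\<^sub>L" 50) where
  "M \<sim>\<^sub>L N \<equiv> algebra_isomorphic (*s) (law M) (*s) (law N)"

text \<open>
  The scaling factors come from solving for the entries \<open>1\<close> of the normal form: \<open>s = a, t = d\<close> in the
  first case, \<open>s = a, t = a\<^sup>2 / b\<close> in the second, and \<open>s = t = c\<close> in the third.
\<close>

lemma rescale_normal_forms:
  fixes a b c d :: "'a::field"
  shows "a \<noteq> 0 \<Longrightarrow> d \<noteq> 0 \<Longrightarrow> (a, b, c, d) \<sim>\<^sub>L (1, b * d / a\<^sup>2, a * c / d\<^sup>2, 1)"
    and "a \<noteq> 0 \<Longrightarrow> b \<noteq> 0 \<Longrightarrow> (a, b, c, 0) \<sim>\<^sub>L (1, 1, b\<^sup>2 * c / a ^ 3, 0)"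
    and "c \<noteq> 0 \<Longrightarrow> (0, b, c, 0) \<sim>\<^sub>L (0, b / c, 1, 0)"
proof -
  show "(a, b, c, d) \<sim>\<^sub>L (1, b * d / a\<^sup>2, a * c / d\<^sup>2, 1)" if "a \<noteq> 0" "d \<noteq> 0"
    using isomorphic_law_rescale[OF that, of "(1, b * d / a\<^sup>2, a * c / d\<^sup>2, 1)"] that
    by (simp add: power2_eq_square)
  show "(a, b, c, 0) \<sim>\<^sub>L (1, 1, b\<^sup>2 * c / a ^ 3, 0)" if "a \<noteq> 0" "b \<noteq> 0"
    using isomorphic_law_rescale[of a "a\<^sup>2 / b" "(1, 1, b\<^sup>2 * c / a ^ 3, 0)"] that
    by (simp add: power2_eq_square power3_eq_cube)
  show "(0, b, c, 0) \<sim>\<^sub>L (0, b / c, 1, 0)" if "c \<noteq> 0"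
    using isomorphic_law_rescale[OF that that, of "(0, b / c, 1, 0)"] that
    by (simp add: power2_eq_square)
qed

text \<open>
  If \<open>a\<close> is the vanishing entry, exchanging the axes moves the zero to the last place.
\<close>

lemma one_zero_normal_form:
  assumes "(a, b, c, d) \<in> nonsingular_laws" "law_invariant (a, b, c, d) = Inr (Inl u)"
  shows "(a, b, c, d) \<sim>\<^sub>L (1, 1, u, 0)"
proof (cases "a = 0")
  case False
  then have "d = 0" "u = b\<^sup>2 * c / a ^ 3" "b \<noteq> 0"
    using assms by (auto simp: nonsingular_laws_def split: if_splits)
  then show ?thesis
    using rescale_normal_forms(2)[OF False, of b c] by simp
next
  case True
  then have "d \<noteq> 0" "u = c\<^sup>2 * b / d ^ 3" "c \<noteq> 0"
    using assms by (auto simp: nonsingular_laws_def split: if_splits)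
  then have "(d, c, b, 0) \<sim>\<^sub>L (1, 1, u, 0)"
    using rescale_normal_forms(2)[of d c b] by simp
  moreover have "(a, b, c, d) \<sim>\<^sub>L (d, c, b, 0)"
    using isomorphic_law_swap_axes[of "(d, c, b, 0)"] True by simp
  ultimately show ?thesis
    using algebra_isomorphic_trans by blast
qed

text \<open>
  Equal invariants give normal forms that agree up to an exchange of axes, except when \<open>a = d = 0\<close>.
  There the normal forms \<open>(0, r, 1, 0)\<close> and \<open>(0, r', 1, 0)\<close> are related by cubes, through the scaling
  \<open>s = w\<^sup>2, t = w\<close>, and by inversion of the parameter, through the exchange of axes followed by
  renormalization. Over a finite field these two moves connect all cubes, and they connect all
  noncubes.
\<close>

lemma isomorphic_if_law_invariant_eq:
  fixes M N :: "'a::{field, finite} \<times> 'a \<times> 'a \<times> 'a"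
  assumes M: "M \<in> nonsingular_laws" and N: "N \<in> nonsingular_laws"
    and eq: "law_invariant M = law_invariant N"
  shows "M \<sim>\<^sub>L N"
proof -
  obtain a b c d where M_eq: "M = (a, b, c, d)"
    by (cases M)
  obtain a' b' c' d' where N_eq: "N = (a', b', c', d')"
    by (cases N)
  \<comment> \<open>It suffices to connect normal forms.\<close>
  have connect: "M \<sim>\<^sub>L N" if "M \<sim>\<^sub>L K" "K \<sim>\<^sub>L L" "N \<sim>\<^sub>L L" for K L
    using that algebra_isomorphic_trans algebra_isomorphic_sym by blast
  have refl: "K \<sim>\<^sub>L K" for K :: "'a \<times> 'a \<times> 'a \<times> 'a"
    by (rule algebra_isomorphic_refl[OF vec.vector_space_axioms])
  consider (two) s where "law_invariant M = Inl s" | (one) u where "law_invariant M = Inr (Inl u)"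
    | (none) p where "law_invariant M = Inr (Inr p)"
    by (metis sumE)
  then show ?thesis
  proof cases
    case two
    define x y x' y' where "x = b * d / a\<^sup>2" and "y = a * c / d\<^sup>2"
      and "x' = b' * d' / a'\<^sup>2" and "y' = a' * c' / d'\<^sup>2"
    have nz: "a \<noteq> 0" "d \<noteq> 0" "a' \<noteq> 0" "d' \<noteq> 0" and set_eq: "{x, y} = {x', y'}"
      using two eq by (auto simp: M_eq N_eq x_def y_def x'_def y'_def split: if_splits)
    have "(1, x, y, 1) \<sim>\<^sub>L (1, x', y', 1)"
      using set_eq isomorphic_law_swap_axes[of "(1, x', y', 1)"] refl
      by (auto simp: doubleton_eq_iff)
    then show ?thesis
      using connect rescale_normal_forms(1)[OF nz(1,2), of b c] rescale_normal_forms(1)[OF nz(3,4), of b' c']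
      unfolding M_eq N_eq x_def y_def x'_def y'_def by blast
  next
    case one
    then have "M \<sim>\<^sub>L (1, 1, u, 0)" "N \<sim>\<^sub>L (1, 1, u, 0)"
      using one_zero_normal_form M N eq unfolding M_eq N_eq by metis+
    then show ?thesis
      using connect refl by blast
  next
    case none
    then have z: "a = 0" "d = 0" "a' = 0" "d' = 0"
      and cube: "(\<exists>z. b / c = z ^ 3) \<longleftrightarrow> (\<exists>z. b' / c' = z ^ 3)"
      using eq by (auto simp: M_eq N_eq split: if_splits)
    then have nz: "b \<noteq> 0" "c \<noteq> 0" "b' \<noteq> 0" "c' \<noteq> 0"
      using M N by (auto simp: M_eq N_eq nonsingular_laws_def)
    define r r' where "r = b / c" and "r' = b' / c'"
    obtain w where w: "w \<noteq> 0" "r = r' * w ^ 3 \<or> r * r' = w ^ 3"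
      using cube_classes_up_to_inversion[OF _ _ cube] nz unfolding r_def r'_def by auto
    have r': "r' \<noteq> 0"
      using nz by (simp add: r'_def)
    have scale: "(0, w ^ 3 * p, 1, 0) \<sim>\<^sub>L (0, p, 1, 0)" for p
      using isomorphic_law_rescale[of "w\<^sup>2" w "(0, p, 1, 0)"] w(1)
      by (simp add: power2_eq_square power3_eq_cube mult.assoc)
    have invert: "(0, inverse p, 1, 0) \<sim>\<^sub>L (0, p, 1, 0)" if "p \<noteq> 0" for p
    proof -
      have "(0, 1, p, 0) \<sim>\<^sub>L (0, inverse p, 1, 0)"
        using rescale_normal_forms(3)[OF that, of 1] by (simp add: inverse_eq_divide)
      moreover have "(0, 1, p, 0) \<sim>\<^sub>L (0, p, 1, 0)"
        using isomorphic_law_swap_axes[of "(0, p, 1, 0)"] by simp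
      ultimately show ?thesis
        using algebra_isomorphic_trans algebra_isomorphic_sym by blast
    qed
    have "(0, r, 1, 0) \<sim>\<^sub>L (0, r', 1, 0)"
      using w(2)
    proof
      assume "r = r' * w ^ 3"
      then show ?thesis
        using scale[of r'] by (simp add: mult.commute)
    next
      assume "r * r' = w ^ 3"
      then have "r = w ^ 3 * inverse r'"
        using r' by (simp add: field_simps)
      then show ?thesis
        using scale[of "inverse r'"] invert[OF r'] algebra_isomorphic_trans by metis
    qed
    then show ?thesis
      using connect rescale_normal_forms(3) nz unfolding M_eq N_eq r_def r'_def z by blast
  qed
qed

lemma isomorphic_iff_law_invariant_eq:
  fixes M N :: "'a::{field, finite} \<times> 'a \<times> 'a \<times> 'a"
  assumes "M \<in> nonsingular_laws" "N \<in> nonsingular_laws"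
  shows "M \<sim>\<^sub>L N \<longleftrightarrow> law_invariant M = law_invariant N"
  using isomorphic_laws_iff[OF assms(2), of M] isomorphic_if_law_invariant_eq[OF assms]
    law_invariant_rescale law_invariant_swap_axes by metis

section \<open>The number of isomorphism classes\<close>

lemma num_idempotent_evolution_algebras_eq_card_invariants:
  "num_idempotent_evolution_algebras TYPE(2) TYPE('a::{field, finite}) =
    card (law_invariant ` (nonsingular_laws :: ('a \<times> 'a \<times> 'a \<times> 'a) set))"
  unfolding num_idempotent_evolution_algebras_def
proof (rule card_quotient_by_complete_invariant[where \<rho> = law, OF equiv_product_isomorphism_rel])
  show "law M \<in> idempotent_evolution_products" if "M \<in> nonsingular_laws" for M :: "'a \<times> 'a \<times> 'a \<times> 'a"
    using that by (simp add: law_in_products_iff)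
next
  fix m :: "'a ^ 2 \<Rightarrow> 'a ^ 2 \<Rightarrow> 'a ^ 2"
  assume m: "m \<in> idempotent_evolution_products"
  then have evo: "evolution_algebra 2 (*s) m" and idem: "idempotent_algebra (*s) m"
    by (simp_all add: idempotent_evolution_products_def)
  obtain M where iso: "algebra_isomorphic (*s) m (*s) (law M)"
    using evolution_product_has_law[OF evo] by blast
  then have "M \<in> nonsingular_laws"
    using idempotent_algebra_if_isomorphic idem idempotent_law_iff by blast
  with m iso show "\<exists>M\<in>nonsingular_laws. (m, law M) \<in> product_isomorphism_rel"
    by (auto simp: product_isomorphism_rel_def law_in_products_iff)
next
  fix M N :: "'a \<times> 'a \<times> 'a \<times> 'a"
  assume "M \<in> nonsingular_laws" "N \<in> nonsingular_laws"
  then show "(law M, law N) \<in> product_isomorphism_rel \<longleftrightarrow> law_invariant M = law_invariant N"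
    by (simp add: product_isomorphism_rel_def law_in_products_iff isomorphic_iff_law_invariant_eq)
qed

text \<open>
  The parameters of the normal forms are restricted only by nonsingularity: \<open>x y \<noteq> 1\<close>, \<open>u \<noteq> 0\<close> and
  \<open>r \<noteq> 0\<close>, respectively.
\<close>

lemma law_invariant_image:
  "law_invariant ` (nonsingular_laws :: ('a::field \<times> 'a \<times> 'a \<times> 'a) set) =
    Inl ` (\<lambda>(x, y). {x, y}) ` {(x, y). x * y \<noteq> 1} \<union> Inr ` Inl ` (UNIV - {0}) \<union>
    Inr ` Inr ` {\<exists>z. r = z ^ 3 | r :: 'a. r \<noteq> 0}" (is "?I = ?X \<union> ?Y \<union> ?Z")
proof (intro equalityI subsetI)
  fix v assume "v \<in> ?I"
  then obtain a b c d :: 'a where v: "v = law_invariant (a, b, c, d)" and det: "a * d \<noteq> b * c"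
    by (auto simp: nonsingular_laws_def)
  consider "a \<noteq> 0" "d \<noteq> 0" | "a \<noteq> 0" "d = 0" | "a = 0" "d \<noteq> 0" | "a = 0" "d = 0"
    by blast
  then show "v \<in> ?X \<union> ?Y \<union> ?Z"
  proof cases
    case 1
    have xy: "(b * d / a\<^sup>2) * (a * c / d\<^sup>2) = b * c / (a * d)"
      using 1 by (simp add: power2_eq_square)
    have "(b * d / a\<^sup>2) * (a * c / d\<^sup>2) \<noteq> 1"
      unfolding xy using 1 det by simp
    then have "(b * d / a\<^sup>2, a * c / d\<^sup>2) \<in> {(x, y). x * y \<noteq> 1}"
      by (simp only: mem_Collect_eq prod.case not_False_eq_True)
    moreover have "v = Inl ((\<lambda>(x, y). {x, y}) (b * d / a\<^sup>2, a * c / d\<^sup>2))"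
      using 1 by (simp add: v)
    ultimately have "v \<in> ?X"
      by blast
    then show ?thesis by blast
  next
    case 4
    then have "b / c \<noteq> 0"
      using det by auto
    then have "(\<exists>z. b / c = z ^ 3) \<in> {\<exists>z. r = z ^ 3 | r :: 'a. r \<noteq> 0}"
      by blast
    moreover have "v = Inr (Inr (\<exists>z. b / c = z ^ 3))"
      using 4 by (simp add: v)
    ultimately have "v \<in> ?Z"
      by (simp only: imageI)
    then show ?thesis ..
  qed (use det in \<open>auto simp: v\<close>)
next
  fix v :: "'a set + 'a + bool" assume "v \<in> ?X \<union> ?Y \<union> ?Z"
  then consider x y where "v = Inl {x, y}" "x * y \<noteq> 1" | u where "v = Inr (Inl u)" "u \<noteq> 0"
    | r :: 'a where "v = Inr (Inr (\<exists>z. r = z ^ 3))" "r \<noteq> 0"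
    by auto
  then show "v \<in> ?I"
  proof cases
    case 1
    then have "v = law_invariant (1, x, y, 1)" "(1, x, y, 1) \<in> nonsingular_laws"
      by (auto simp: nonsingular_laws_def)
    then show ?thesis by blast
  next
    case 2
    then have "v = law_invariant (1, 1, u, 0)" "(1, 1, u, 0) \<in> nonsingular_laws"
      by (auto simp: nonsingular_laws_def)
    then show ?thesis by blast
  next
    case 3
    then have "v = law_invariant (0, r, 1, 0)" "(0, r, 1, 0) \<in> nonsingular_laws"
      by (auto simp: nonsingular_laws_def)
    then show ?thesis by blast
  qed
qed

lemma card_pairs_with_product_ne_1:
  "card {(x, y). x * y \<noteq> (1 :: 'a::{field, finite})} + CARD('a) = CARD('a)\<^sup>2 + 1"
proof -
  have "{(x, y). x * y = (1 :: 'a)} = (\<lambda>x. (x, inverse x)) ` (UNIV - {0})"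
    by (auto simp: image_iff inverse_unique)
  then have inverse_pairs: "card {(x, y). x * y = (1 :: 'a)} = CARD('a) - 1"
    by (simp add: card_image inj_on_def card_Diff_singleton)
  have "{(x, y). x * y \<noteq> (1 :: 'a)} \<union> {(x, y). x * y = 1} = UNIV \<times> UNIV"
    by auto
  then have "card {(x, y). x * y \<noteq> (1 :: 'a)} + card {(x, y). x * y = (1 :: 'a)} = CARD('a)\<^sup>2"
    by (subst card_Un_disjoint[symmetric]) (auto simp: card_cartesian_product power2_eq_square)
  moreover have "0 < CARD('a)"
    by simp
  ultimately show ?thesis
    unfolding inverse_pairs by linarith
qed

text \<open>
  The solutions \<open>1\<close> and \<open>-1\<close> of \<open>x\<^sup>2 = 1\<close> coincide exactly in characteristic two; this is the source of
  the case distinction on \<open>p\<close>.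
\<close>

lemma card_square_ne_1:
  "card {x. x * x \<noteq> (1 :: 'a::{field, finite})} + (if (2 :: 'a) = 0 then 1 else 2) = CARD('a)"
proof -
  have sq: "{x. x * x = (1 :: 'a)} = {1, - 1}"
    by (auto simp: square_eq_1_iff)
  have "(1 :: 'a) = - 1 \<longleftrightarrow> (2 :: 'a) = 0"
    by (metis add_eq_0_iff one_add_one)
  then have "card {x. x * x = (1 :: 'a)} = (if (2 :: 'a) = 0 then 1 else 2)"
    unfolding sq by (simp add: card_insert_if)
  moreover have "{x. x * x \<noteq> (1 :: 'a)} \<union> {x. x * x = 1} = UNIV"
    by auto
  then have "card {x. x * x \<noteq> (1 :: 'a)} + card {x. x * x = (1 :: 'a)} = CARD('a)"
    by (subst card_Un_disjoint[symmetric]) auto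
  ultimately show ?thesis
    by simp
qed

lemma card_cube_classes:
  "card {\<exists>z :: 'a::{field, finite}. r = z ^ 3 | r. r \<noteq> 0} = (if 3 dvd (CARD('a) - 1) then 2 else 1)"
    (is "card ?B = _")
proof -
  have "\<exists>z. (1 :: 'a) = z ^ 3"
    by (rule exI[of _ 1]) simp
  then have T: "True \<in> ?B"
    by (intro CollectI exI[of _ 1]) simp
  show ?thesis
  proof (cases "3 dvd (CARD('a) - 1)")
    case True
    then obtain r :: 'a where "\<not> (\<exists>z. r = z ^ 3)"
      using cubes_if_3_dvd(2) by blast
    moreover from this have "r \<noteq> 0"
      by (metis zero_power zero_less_numeral)
    ultimately have "False \<in> ?B"
      by blast
    with T have "?B = {True, False}"
      by blast
    then show ?thesis
      using True by simp
  next
    case False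
    then have "?B = {True}"
      using T all_cubes_if_not_3_dvd[OF False] by blast
    then show ?thesis
      using False by simp
  qed
qed

lemma two_eq_0_iff_base_prime_eq_2:
  fixes p m :: nat
  assumes "prime p" "CARD('a::{field, finite}) = p ^ m"
  shows "(2 :: 'a) = 0 \<longleftrightarrow> p = 2"
proof -
  have "prime CHAR('a)"
    by (intro prime_CHAR_semidom finite_imp_CHAR_pos) simp
  moreover have "CHAR('a) dvd p ^ m"
    using CHAR_dvd_CARD[where ?'a = 'a] assms(2) by simp
  ultimately have "CHAR('a) = p"
    using assms(1) prime_dvd_power primes_dvd_imp_eq by blast
  moreover have "of_nat 2 = (0 :: 'a) \<longleftrightarrow> CHAR('a) dvd 2"
    by (rule of_nat_eq_0_iff_char_dvd)
  ultimately show ?thesis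
    using assms(1) two_is_prime_nat primes_dvd_imp_eq by (metis dvd_refl of_nat_numeral)
qed

text \<open>
  Twice the three contributions: \<open>q\<^sup>2 - q + 1\<close> ordered pairs with \<open>x y \<noteq> 1\<close> plus \<open>q - \<epsilon>\<close> diagonal ones,
  where \<open>\<epsilon>\<close> is the number of square roots of \<open>1\<close>; \<open>2 (q - 1)\<close> for one vanishing diagonal entry; and
  \<open>2\<close> or \<open>4\<close> for two. Terms are arranged so that no subtraction of \<open>\<epsilon>\<close> occurs on natural numbers.
\<close>

lemma num_idempotent_evolution_algebras_dim_2:
  "2 * num_idempotent_evolution_algebras TYPE(2) TYPE('a::{field, finite}) + (if (2 :: 'a) = 0 then 1 else 2) =
    (CARD('a) + 1)\<^sup>2 + (if 3 dvd (CARD('a) - 1) then 2 else 0)"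
proof -
  let ?D = "{(x, y). x * y \<noteq> (1 :: 'a)}" and ?q = "CARD('a)"
  let ?X = "(\<lambda>(x, y). {x, y}) ` ?D" and ?B = "{\<exists>z :: 'a. r = z ^ 3 | r. r \<noteq> 0}"
  let ?N = "num_idempotent_evolution_algebras TYPE(2) TYPE('a)"
  have "?N = card (Inl ` ?X \<union> Inr ` Inl ` (UNIV - {0 :: 'a}) \<union> Inr ` Inr ` ?B :: ('a set + 'a + bool) set)"
    unfolding num_idempotent_evolution_algebras_eq_card_invariants law_invariant_image ..
  also have "\<dots> = card ?X + card (UNIV - {0 :: 'a}) + card ?B"
    by (subst card_Un_disjoint, simp, simp, blast, subst card_Un_disjoint, simp, simp, blast)
      (simp add: card_image inj_on_def)
  finally have N: "?N = card ?X + (?q - 1) + card ?B"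
    by (simp add: card_Diff_singleton)
  have "2 * card ?X = card ?D + card {x. (x, x) \<in> ?D}"
    by (rule card_unordered_pairs) (auto simp: mult.commute)
  then have X: "2 * card ?X = card ?D + card {x. x * x \<noteq> (1 :: 'a)}"
    by simp
  have "0 < ?q"
    by simp
  then show ?thesis
    using X N card_pairs_with_product_ne_1[where ?'a = 'a] card_square_ne_1[where ?'a = 'a]
      card_cube_classes[where ?'a = 'a]
    by (simp add: power2_eq_square split: if_splits)
qed

theorem theorem4p1:
  fixes p m q :: nat
  assumes "prime p"
    and "q = p ^ m"
    and "CARD('a::{field, finite}) = q"
  shows "real (num_idempotent_evolution_algebras TYPE(2) TYPE('a)) =
    (if p = 2 \<and> 3 dvd (q - 1) then (real q + 1)\<^sup>2 / 2 + 1 / 2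
     else if p = 2 \<and> \<not> 3 dvd (q - 1) then (real q + 1)\<^sup>2 / 2 - 1 / 2
     else if p \<noteq> 2 \<and> 3 dvd (q - 1) then (real q + 1)\<^sup>2 / 2
     else (real q + 1)\<^sup>2 / 2 - 1)"
proof -
  have "real (2 * num_idempotent_evolution_algebras TYPE(2) TYPE('a) + (if p = 2 then 1 else 2)) =
      real ((q + 1)\<^sup>2 + (if 3 dvd (q - 1) then 2 else 0))"
    using num_idempotent_evolution_algebras_dim_2[where ?'a = 'a] two_eq_0_iff_base_prime_eq_2[OF assms(1), of m, where ?'a = 'a] assms
    by simp
  then have "2 * real (num_idempotent_evolution_algebras TYPE(2) TYPE('a)) + (if p = 2 then 1 else 2) =
      (real q + 1)\<^sup>2 + (if 3 dvd (q - 1) then 2 else 0)"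
    by (simp add: add.commute split: if_splits)
  then show ?thesis
    by (auto split: if_splits)
qed

end
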